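(* Let $r\ge 0$ be an integer, $\mu_r\in\mathbb{C}$, and write $r=2r'$ or $r=2r'+1$ with $r'\ge0$ an integer. Let $\lambda^{tX}_{n,m}$ be the coefficients in $P^{t}_n(\mu_r;r)(x)=\sum_{m=0}^{n}\lambda^{tX}_{n,m}x^m$. Then: \begin{enumerate} \item For $0\le k'\le r'$ (for $r=2r'$ or $r=2r'+1$): $$\lambda^{tX}_{2k',2\nu}=\frac{(-1)^{k'-\nu}}{4^{k'-\nu}}\binom{k'+\nu}{k'-\nu},\ 0\le\nu\le k';\qquad \lambda^{tX}_{2k',2\nu+1}=0,\ 0\le\nu\le k'-1.$$ \item For $0\le k'\le r'-1$ if $r=2r'$, or for $0\le k'\le r'$ if $r=2r'+1$: $$\lambda^{tX}_{2k'+1,2\nu+1}=\frac{(-1)^{k'-\nu}}{4^{k'-\nu}}\binom{k'+\nu+1}{k'-\nu},\ 0\le\nu\le k';\qquad \lambda^{tX}_{2k'+1,2\nu}=0,\ 0\le\nu\le k'.$$ \item For $r'+1\le k'\le r$ (for $r=2r'$ or $r=2r'+1$): $$\lambda^{tX}_{2k',2\nu}=\frac{(-1)^{k'-\nu}}{4^{k'-\nu}}\binom{k'+\nu}{k'-\nu},\quad 0\le\nu\le k',$$ $$\lambda^{tX}_{2k',2\nu+1}=-\frac{\mu_r}{4^{k'-\nu-1}}\sum_{j=r-k'}^{k'-1}(-1)^{j-\nu}\binom{j+\nu+1}{j-\nu},\quad 0\le\nu\le r-k'-1,$$ $$\lambda^{tX}_{2k',2\nu+1}=-\frac{\mu_r}{4^{k'-\nu-1}}\sum_{j=\nu}^{k'-1}(-1)^{j-\nu}\binom{j+\nu+1}{j-\nu},\quad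 r-k'\le\nu\le k'-1.$$ \item For $r'\le k'\le r-1$ if $r=2r'$, or for $r'+1\le k'\le r-1$ if $r=2r'+1$: $$\lambda^{tX}_{2k'+1,2\nu+1}=\frac{(-1)^{k'-\nu}}{4^{k'-\nu}}\binom{k'+\nu+1}{k'-\nu},\quad 0\le\nu\le k',$$ $$\lambda^{tX}_{2k'+1,2\nu}=-\frac{\mu_r}{4^{k'-\nu}}\sum_{j=r-k'}^{k'}(-1)^{j-\nu}\binom{j+\nu}{j-\nu},\quad 0\le\nu\le r-k'-1,$$ $$\lambda^{tX}_{2k'+1,2\nu}=-\frac{\mu_r}{4^{k'-\nu}}\sum_{j=\nu}^{k'}(-1)^{j-\nu}\binom{j+\nu}{j-\nu},\quad r-k'\le\nu\le k'.$$ \item For $n\ge 0$: $$\lambda^{tX}_{2(n+r)+1,2\nu+1}=\frac{(-1)^{n+r-\nu}}{4^{n+r-\nu}}\binom{n+r+\nu+1}{n+r-\nu},\quad 0\le\nu\le n+r,$$ $$\lambda^{tX}_{2(n+r)+1,2\nu}=-\frac{\mu_r}{4^{n+r-\nu}}\sum_{j=n}^{n+r}(-1)^{j-\nu}\binom{j+\nu}{j-\nu},\quad 0\le\nu\le n-1,$$ $$\lambda^{tX}_{2(n+r)+1,2\nu}=-\frac{\mu_r}{4^{n+r-\nu}}\sum_{j=\nu}^{n+r}(-1)^{j-\nu}\binom{j+\nu}{j-\nu},\quad n\le\nu\le n+r,$$ $$\lambda^{tX}_{2(n+r+1),2\nu}=\frac{(-1)^{n+r+1-\nu}}{4^{n+r+1-\nu}}\binom{n+r+1+\nu}{n+r+1-\nu},\quad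 0\le\nu\le n+r+1,$$ $$\lambda^{tX}_{2(n+r+1),2\nu+1}=-\frac{\mu_r}{4^{n+r-\nu}}\sum_{j=n}^{n+r}(-1)^{j-\nu}\binom{j+\nu+1}{j-\nu},\quad 0\le\nu\le n-1,$$ $$\lambda^{tX}_{2(n+r+1),2\nu+1}=-\frac{\mu_r}{4^{n+r-\nu}}\sum_{j=\nu}^{n+r}(-1)^{j-\nu}\binom{j+\nu+1}{j-\nu},\quad n\le\nu\le n+r.$$ \end{enumerate}
   Context: For an integer $r\ge 0$ and $\mu_r\in\mathbb{C}$, the $r$th-perturbed by translation sequence $\{P^t_n(\mu_r;r)\}_{n\ge 0}$ of the monic Chebyshev polynomials of the second kind is the monic sequence with $P^t_0=1$, $P^t_1(x)=x-\beta_0$, $P^t_{n+2}(x)=(x-\beta_{n+1})P^t_{n+1}(x)-\frac14P^t_n(x)$ for $n\ge 0$, where $\beta_r=\mu_r$ and $\beta_n=0$ for $n\ne r$. Index ranges whose upper bound is smaller than the lower bound are empty. *)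

theory Defs
  imports Complex_Main "HOL-Computational_Algebra.Polynomial"
begin

(* The monic Chebyshev polynomials of the second kind have recurrence coefficients
   beta n = 0 and gamma (n + 1) = 1/4; the perturbation by translation replaces beta r by mu. *)
definition pert_beta :: "complex \<Rightarrow> nat \<Rightarrow> nat \<Rightarrow> complex" where
  "pert_beta \<mu> r n = (if n = r then \<mu> else 0)"

fun Pt :: "complex \<Rightarrow> nat \<Rightarrow> nat \<Rightarrow> complex poly" where
  "Pt \<mu> r 0 = 1"
| "Pt \<mu> r (Suc 0) = [:- pert_beta \<mu> r 0, 1:]"
| "Pt \<mu> r (Suc (Suc n)) =
     [:- pert_beta \<mu> r (Suc n), 1:] * Pt \<mu> r (Suc n) - smult (1/4) (Pt \<mu> r n)"

definition lambda_tX :: "complex \<Rightarrow> nat \<Rightarrow> nat \<Rightarrow> nat \<Rightarrow> complex" where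
  "lambda_tX \<mu> r n m = coeff (Pt \<mu> r n) m"

lemma degree_Pt_le: "degree (Pt \<mu> r n) \<le> n"
proof (induction \<mu> r n rule: Pt.induct)
  case (3 \<mu> r n)
  have "degree ([:- pert_beta \<mu> r (Suc n), 1:] * Pt \<mu> r (Suc n)) \<le> Suc (Suc n)"
    by (rule order_trans[OF degree_mult_le]) (use 3(1) in simp)
  moreover have "degree (smult (1/4) (Pt \<mu> r n)) \<le> Suc (Suc n)"
    using 3(2) by simp
  ultimately show ?case
    by (simp add: degree_diff_le)
qed simp_all

lemma poly_Pt_eq_sum_lambda:
  "poly (Pt \<mu> r n) x = (\<Sum>m=0..n. lambda_tX \<mu> r n m * x ^ m)"
proof -
  have "(\<Sum>m=0..n. lambda_tX \<mu> r n m * x ^ m) = (\<Sum>m\<le>degree (Pt \<mu> r n). coeff (Pt \<mu> r n) m * x ^ m)"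
    unfolding lambda_tX_def
    by (rule sum.mono_neutral_right) (use degree_Pt_le[of \<mu> r n] in \<open>auto intro: coeff_eq_0\<close>)
  then show ?thesis by (simp add: poly_altdef)
qed

end

theory Submission
  imports Defs
begin

text \<open>With \<open>C\<^sub>n\<close> the unperturbed monic polynomials, comparing recurrences gives
  \<open>P\<^sub>n = C\<^sub>n\<close> for \<open>n \<le> r\<close> and \<open>P\<^sub>n = C\<^sub>n - \<mu> C\<^sub>r C\<^bsub>n-r-1\<^esub>\<close> for \<open>n > r\<close>. The product linearizes
  through \<open>C\<^bsub>a+1\<^esub> C\<^bsub>b+1\<^esub> = C\<^bsub>a+b+2\<^esub> + C\<^sub>a C\<^sub>b / 4\<close>, whose iteration stops at the smaller index;
  that is where the lower summation limit \<open>\<bar>r - k'\<bar>\<close> comes from. Only terms of the parity of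
  \<open>n - 1\<close> occur in the product, so the coefficients of the parity of \<open>n\<close> are unperturbed.\<close>

section \<open>Coefficients of the unperturbed polynomials\<close>

fun chebU_monic :: "nat \<Rightarrow> complex poly" where
  "chebU_monic 0 = 1"
| "chebU_monic (Suc 0) = [:0, 1:]"
| "chebU_monic (Suc (Suc n)) = [:0, 1:] * chebU_monic (Suc n) - smult (1/4) (chebU_monic n)"

text \<open>In the generic case \<open>n = m + 2 * d\<close> both contributions of the recurrence
  share the factor \<open>(-1/4)^(d + 1)\<close>, and Pascal's rule adds their binomials. The
  recurrence also calls on position \<open>m - 1\<close>, so \<open>m\<close> stays arbitrary in the
  induction.\<close>

lemma coeff_chebU_monic:
  "coeff (chebU_monic n) m =
    (if m \<le> n \<and> even (n + m)
     then (-1) ^ ((n - m) div 2) / 4 ^ ((n - m) div 2)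
       * of_nat ((n + m) div 2 choose ((n - m) div 2)) else 0)"
proof (induction n arbitrary: m rule: chebU_monic.induct)
  case 1
  then show ?case by (simp add: odd_pos)
next
  case 2
  then show ?case by (auto simp: coeff_pCons split: nat.split)
next
  case (3 n)
  show ?case
  proof (cases "m \<le> n \<and> even (n + m)")
    case True
    then obtain d where n: "n = m + 2 * d"
      by (metis le_add_diff_inverse dvdE even_diff_nat)
    note IH = 3[unfolded n]
    have half: "(m + 2 * d + m) div 2 = m + d" "(Suc (Suc (m + 2 * d)) + m) div 2 = Suc (m + d)"
        "(Suc (Suc (m + 2 * d)) - m) div 2 = Suc d"
      by simp_all
    have pascal: "of_nat (Suc (m + d) choose Suc d) =
        (of_nat (m + d choose d) + of_nat (m + d choose Suc d) :: complex)"
      by simp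
    \<comment> \<open>Raising the exponent from \<open>d\<close> to \<open>Suc d\<close> absorbs the
      sign and the factor 1/4, turning the subtraction of the recurrence into the sum in Pascal's
      rule.\<close>
    have step: "(-1) ^ Suc d / 4 ^ Suc d * B - (-1) ^ d / 4 ^ d * A / 4 =
        (-1) ^ Suc d / 4 ^ Suc d * (A + B)" for A B :: complex
      by (simp add: distrib_left)
    show ?thesis
    proof (cases m)
      \<comment> \<open>A multiple of x has no constant term, so only the polynomial of index
        \<open>n\<close> contributes; both binomials are 1.\<close>
      case 0
      then show ?thesis using IH(2)[of 0] by (simp add: n)
    next
      case (Suc m')
      have upper: "coeff (chebU_monic (Suc (m + 2 * d))) m' =
          (-1) ^ Suc d / 4 ^ Suc d * of_nat (m + d choose Suc d)"
        unfolding IH(1) by (simp add: Suc)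
      have lower: "coeff (chebU_monic (m + 2 * d)) m =
          (-1) ^ d / 4 ^ d * of_nat (m + d choose d)"
        unfolding IH(2) by (simp add: half)
      have rec: "coeff (chebU_monic (Suc (Suc (m + 2 * d)))) m =
          coeff (chebU_monic (Suc (m + 2 * d))) m' - coeff (chebU_monic (m + 2 * d)) m / 4"
        by (simp add: Suc)
      have "coeff (chebU_monic (Suc (Suc (m + 2 * d)))) m =
          (-1) ^ Suc d / 4 ^ Suc d * of_nat (Suc (m + d) choose Suc d)"
        unfolding rec upper lower pascal by (simp only: step)
      moreover have "m \<le> Suc (Suc (m + 2 * d)) \<and> even (Suc (Suc (m + 2 * d)) + m)"
        by simp
      ultimately show ?thesis
        by (simp only: n half simp_thms if_True)
    qed
  next
    case False
    show ?thesis
    \<comment> \<open>Outside the generic case only the leading coefficient is nonzero, and it is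
      inherited from index \<open>n + 1\<close>.\<close>
    proof (cases "even (n + m) \<and> m = n + 2")
      case True
      then have m: "m = Suc (Suc n)"
        by simp
      have "coeff (chebU_monic (Suc n)) (Suc n) = 1"
        unfolding 3(1) by simp
      moreover have "coeff (chebU_monic n) (Suc (Suc n)) = 0"
        unfolding 3(2) by simp
      ultimately have "coeff (chebU_monic (Suc (Suc n))) (Suc (Suc n)) = 1"
        by simp
      then show ?thesis
        unfolding m by (simp del: chebU_monic.simps)
    next
      case odd: False
      have "coeff (chebU_monic n) m = 0"
        unfolding 3(2) by (rule if_not_P[OF False])
      moreover have "coeff (chebU_monic (Suc n)) m' = 0" if "m = Suc m'" for m'
      proof -
        have "\<not> (m' \<le> Suc n \<and> even (Suc n + m'))"
          using False odd that by presburger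
        then show ?thesis unfolding 3(1) by (rule if_not_P)
      qed
      ultimately have "coeff (chebU_monic (Suc (Suc n))) m = 0"
        by (cases m) simp_all
      moreover have "\<not> (m \<le> Suc (Suc n) \<and> even (Suc (Suc n) + m))"
        using False odd by presburger
      ultimately show ?thesis by (simp only: if_False)
    qed
  qed
qed

text \<open>The offset \<open>e\<close> lets one formula serve both parities, through
  \<open>e = 0\<close> and \<open>e = 1\<close>.\<close>

lemma coeff_chebU_monic_same_parity:
  assumes "\<nu> \<le> k"
  shows "coeff (chebU_monic (2 * k + e)) (2 * \<nu> + e) =
    (-1) ^ (k - \<nu>) / 4 ^ (k - \<nu>) * of_nat ((k + \<nu> + e) choose (k - \<nu>))"
proof -
  have "2 * k + e - (2 * \<nu> + e) = 2 * (k - \<nu>)" "2 * k + e + (2 * \<nu> + e) = 2 * (k + \<nu> + e)"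
    by simp_all
  then show ?thesis using assms by (simp only: coeff_chebU_monic) simp
qed

section \<open>Linearization of products\<close>

text \<open>For fixed \<open>b\<close> both sides obey the same three-term recurrence in
  \<open>a\<close>, so the cases \<open>a = 0\<close> and \<open>a = 1\<close> decide. The case
  \<open>a = 0\<close> is the recurrence itself.\<close>

lemma chebU_monic_mult_Suc:
  "chebU_monic (Suc a) * chebU_monic (Suc b) =
    chebU_monic (Suc (Suc (a + b))) + smult (1/4) (chebU_monic a * chebU_monic b)"
proof (induction a arbitrary: b rule: chebU_monic.induct)
  case (3 a)
  have "chebU_monic (Suc (Suc (Suc a))) * chebU_monic (Suc b) =
      [:0, 1:] * (chebU_monic (Suc (Suc a)) * chebU_monic (Suc b))
      - smult (1/4) (chebU_monic (Suc a) * chebU_monic (Suc b))"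
    by (subst chebU_monic.simps(3)) (simp add: algebra_simps del: chebU_monic.simps(3))
  also have "\<dots> = [:0, 1:] * chebU_monic (Suc (Suc (Suc (a + b)))) - smult (1/4) (chebU_monic (Suc (Suc (a + b))))
      + smult (1/4) (([:0, 1:] * chebU_monic (Suc a) - smult (1/4) (chebU_monic a)) * chebU_monic b)"
    unfolding 3 by (simp add: algebra_simps smult_add_right smult_diff_right)
  finally show ?case by simp
next
  case 2
  then show ?case by (cases b) (simp_all add: algebra_simps smult_diff_right smult_add_right)
qed simp_all

text \<open>Writing the larger index as \<open>a + d\<close> keeps the gap \<open>d\<close> fixed
  while both indices descend, each step costing a factor 1/4, until the product is
  \<open>chebU_monic d\<close>.\<close>

lemma chebU_monic_mult:
  "chebU_monic a * chebU_monic (a + d) =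
    (\<Sum>i\<le>a. smult (1 / 4 ^ (a - i)) (chebU_monic (2 * i + d)))"
proof (induction a)
  case (Suc a)
  have "chebU_monic (Suc a) * chebU_monic (Suc a + d) =
      chebU_monic (2 * Suc a + d)
      + smult (1/4) (\<Sum>i\<le>a. smult (1 / 4 ^ (a - i)) (chebU_monic (2 * i + d)))"
    using chebU_monic_mult_Suc[of a "a + d"] by (simp add: Suc flip: add.assoc mult_2)
  also have "smult (1/4) (\<Sum>i\<le>a. smult (1 / 4 ^ (a - i)) (chebU_monic (2 * i + d)))
      = (\<Sum>i\<le>a. smult (1 / 4 ^ (Suc a - i)) (chebU_monic (2 * i + d)))"
    by (intro poly_eqI) (simp add: coeff_sum sum_divide_distrib Suc_diff_le field_simps)
  finally show ?case by simp
qed simp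

lemma coeff_chebU_monic_mult_odd:
  assumes "odd (a + b + m)"
  shows "coeff (chebU_monic a * chebU_monic b) m = 0"
proof -
  have *: "coeff (chebU_monic a * chebU_monic (a + d)) m = 0" if "odd (d + m)" for a d
    using that unfolding chebU_monic_mult
    by (intro trans[OF coeff_sum] sum.neutral) (auto simp: coeff_chebU_monic)
  show ?thesis
  proof (cases "a \<le> b")
    case True
    then show ?thesis using assms *[of "b - a" a] by auto
  next
    case False
    then show ?thesis using assms *[of "a - b" b] by (auto simp: mult.commute)
  qed
qed

text \<open>The index gap is \<open>2 * l + e\<close>, so the shift \<open>j = i + l\<close> turns
  the linearized terms into \<open>chebU_monic (2 * j + e)\<close>. The descent ends at
  \<open>j = l\<close>, and terms with \<open>j < \<nu>\<close> have too small a degree; hence the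
  lower limit \<open>max l \<nu>\<close>.\<close>

lemma coeff_chebU_monic_mult:
  assumes "\<nu> \<le> l + a"
  shows "coeff (chebU_monic a * chebU_monic (a + 2 * l + e)) (2 * \<nu> + e) =
    (\<Sum>j=max l \<nu>..l + a. (-1) ^ (j - \<nu>) * of_nat ((j + \<nu> + e) choose (j - \<nu>))) / 4 ^ (l + a - \<nu>)"
proof -
  have "coeff (chebU_monic a * chebU_monic (a + 2 * l + e)) (2 * \<nu> + e) =
      (\<Sum>i\<le>a. coeff (chebU_monic (2 * (i + l) + e)) (2 * \<nu> + e) / 4 ^ (a - i))"
    using chebU_monic_mult[of a "2 * l + e"] by (simp add: coeff_sum algebra_simps)
  also have "\<dots> = (\<Sum>j=l..l + a. coeff (chebU_monic (2 * j + e)) (2 * \<nu> + e) / 4 ^ (l + a - j))"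
    by (rule sum.reindex_bij_witness[of _ "\<lambda>j. j - l" "\<lambda>i. i + l"]) auto
  also have "\<dots> = (\<Sum>j=max l \<nu>..l + a. coeff (chebU_monic (2 * j + e)) (2 * \<nu> + e) / 4 ^ (l + a - j))"
    by (rule sum.mono_neutral_right) (auto simp: coeff_chebU_monic)
  \<comment> \<open>The powers of 4 from the coefficient and from the linearization multiply to one
    independent of \<open>j\<close>, which then leaves the sum.\<close>
  also have "\<dots> = (\<Sum>j=max l \<nu>..l + a.
      (-1) ^ (j - \<nu>) * of_nat ((j + \<nu> + e) choose (j - \<nu>)) / 4 ^ (l + a - \<nu>))"
  proof (rule sum.cong[OF refl])
    fix j assume j: "j \<in> {max l \<nu>..l + a}"
    then have "l + a - \<nu> = (j - \<nu>) + (l + a - j)" by auto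
    then have "(4::complex) ^ (l + a - \<nu>) = 4 ^ (j - \<nu>) * 4 ^ (l + a - j)"
      by (metis power_add)
    with j show "coeff (chebU_monic (2 * j + e)) (2 * \<nu> + e) / 4 ^ (l + a - j) =
        (-1) ^ (j - \<nu>) * of_nat ((j + \<nu> + e) choose (j - \<nu>)) / 4 ^ (l + a - \<nu>)"
      by (simp add: coeff_chebU_monic_same_parity)
  qed
  finally show ?thesis by (simp add: sum_divide_distrib)
qed

section \<open>Perturbed polynomials in terms of unperturbed ones\<close>

text \<open>The perturbed coefficient first enters when the polynomial of index \<open>r + 1\<close>
  is formed.\<close>

lemma Pt_eq_chebU_monic: "n \<le> r \<Longrightarrow> Pt \<mu> r n = chebU_monic n"
  by (induction n rule: chebU_monic.induct) (auto simp: pert_beta_def)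

text \<open>Beyond index \<open>r\<close> all \<open>pert_beta\<close> vanish, so both sides satisfy
  the unperturbed recurrence in \<open>n\<close>, and agreement at \<open>n = 0\<close> and
  \<open>n = 1\<close> suffices.\<close>

lemma Pt_eq_chebU_monic_diff:
  "Pt \<mu> r (r + 1 + n) =
    chebU_monic (r + 1 + n) - smult \<mu> (chebU_monic r * chebU_monic n)"
proof (induction n rule: chebU_monic.induct)
  case 1
  show ?case
    \<comment> \<open>Index one has its own defining equation, which carries \<open>\<mu>\<close>
      when \<open>r = 0\<close>; otherwise the general recurrence does.\<close>
    by (cases r) (simp_all add: Pt_eq_chebU_monic pert_beta_def)
next
  case 2
  have "Pt \<mu> r (Suc r) = chebU_monic (Suc r) - smult \<mu> (chebU_monic r)"
    by (cases r) (simp_all add: Pt_eq_chebU_monic pert_beta_def)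
  then show ?case
    by (simp add: Pt_eq_chebU_monic pert_beta_def algebra_simps smult_diff_right)
next
  case (3 n)
  have "Pt \<mu> r (r + 1 + Suc (Suc n)) =
      [:0, 1:] * Pt \<mu> r (r + 1 + Suc n) - smult (1/4) (Pt \<mu> r (r + 1 + n))"
    by (simp add: pert_beta_def)
  also have "\<dots> = ([:0, 1:] * chebU_monic (r + 1 + Suc n) - smult (1/4) (chebU_monic (r + 1 + n)))
      - smult \<mu> (chebU_monic r * ([:0, 1:] * chebU_monic (Suc n) - smult (1/4) (chebU_monic n)))"
    unfolding 3 by (simp add: algebra_simps smult_add_right smult_diff_right)
  finally show ?case by simp
qed

section \<open>Coefficients of the perturbed polynomials\<close>

lemma lambda_tX_same_parity:
  assumes "\<nu> \<le> k"
  shows "lambda_tX \<mu> r (2 * k + e) (2 * \<nu> + e) =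
    (-1) ^ (k - \<nu>) / 4 ^ (k - \<nu>) * of_nat ((k + \<nu> + e) choose (k - \<nu>))"
proof -
  have "lambda_tX \<mu> r (2 * k + e) (2 * \<nu> + e) = coeff (chebU_monic (2 * k + e)) (2 * \<nu> + e)"
  proof (cases "2 * k + e \<le> r")
    case True
    then show ?thesis by (simp add: lambda_tX_def Pt_eq_chebU_monic)
  next
    case False
    then obtain n where n: "2 * k + e = r + 1 + n"
      by (metis Suc_eq_plus1 not_less_eq_eq le_Suc_ex)
    \<comment> \<open>The correction is a product whose indices add up to one less than
      \<open>2 * k + e\<close>, hence it has the wrong parity.\<close>
    then have "odd (r + n + (2 * \<nu> + e))" by presburger
    then show ?thesis
      unfolding lambda_tX_def n Pt_eq_chebU_monic_diff by (simp add: coeff_chebU_monic_mult_odd)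
  qed
  with assms show ?thesis by (simp add: coeff_chebU_monic_same_parity)
qed

lemma lambda_tX_unperturbed_odd:
  assumes "n \<le> r" "odd (n + m)"
  shows "lambda_tX \<mu> r n m = 0"
  using assms by (auto simp: lambda_tX_def Pt_eq_chebU_monic coeff_chebU_monic)

text \<open>The two factors of the correction have indices \<open>a\<close> and
  \<open>a + 2 * l + e\<close>, and either may be \<open>r\<close>. It is the larger one in the
  intermediate range of degrees and the smaller one in the final range.\<close>

lemma lambda_tX_opposite_parity:
  assumes r: "r = a \<or> r = a + 2 * l + e" and "\<nu> \<le> l + a"
  shows "lambda_tX \<mu> r (2 * (l + a) + e + 1) (2 * \<nu> + e) =
    - \<mu> / 4 ^ (l + a - \<nu>) *
    (\<Sum>j=max l \<nu>..l + a. (-1) ^ (j - \<nu>) * of_nat ((j + \<nu> + e) choose (j - \<nu>)))"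
proof -
  let ?n = "2 * (l + a) + e + 1"
  have "Pt \<mu> r ?n = chebU_monic ?n - smult \<mu> (chebU_monic a * chebU_monic (a + 2 * l + e))"
    using r
  proof
    assume "r = a"
    then show ?thesis
      using Pt_eq_chebU_monic_diff[of \<mu> r "a + 2 * l + e"] by (simp add: algebra_simps)
  next
    assume "r = a + 2 * l + e"
    then show ?thesis
      using Pt_eq_chebU_monic_diff[of \<mu> r a] by (simp add: algebra_simps)
  qed
  moreover have "coeff (chebU_monic ?n) (2 * \<nu> + e) = 0"
    by (simp add: coeff_chebU_monic)
  ultimately show ?thesis
    using assms(2) by (simp add: lambda_tX_def coeff_chebU_monic_mult)
qed

theorem theorem4p3:
  fixes \<mu> :: complex and r r' :: nat
  assumes "r = 2 * r' \<or> r = 2 * r' + 1"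
  shows "(\<forall>k'. k' \<le> r' \<longrightarrow>
      (\<forall>\<nu>. \<nu> \<le> k' \<longrightarrow>
        lambda_tX \<mu> r (2 * k') (2 * \<nu>) =
          (-1) ^ (k' - \<nu>) / 4 ^ (k' - \<nu>) * of_nat ((k' + \<nu>) choose (k' - \<nu>))) \<and>
      (\<forall>\<nu>. \<nu> < k' \<longrightarrow>
        lambda_tX \<mu> r (2 * k') (2 * \<nu> + 1) =
          0))
    \<and> (\<forall>k'. (r = 2 * r' \<and> k' < r') \<or> (r = 2 * r' + 1 \<and> k' \<le> r') \<longrightarrow>
      (\<forall>\<nu>. \<nu> \<le> k' \<longrightarrow>
        lambda_tX \<mu> r (2 * k' + 1) (2 * \<nu> + 1) =
          (-1) ^ (k' - \<nu>) / 4 ^ (k' - \<nu>) * of_nat ((k' + \<nu> + 1) choose (k' - \<nu>))) \<and>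
      (\<forall>\<nu>. \<nu> \<le> k' \<longrightarrow>
        lambda_tX \<mu> r (2 * k' + 1) (2 * \<nu>) =
          0))
    \<and> (\<forall>k'. r' + 1 \<le> k' \<and> k' \<le> r \<longrightarrow>
      (\<forall>\<nu>. \<nu> \<le> k' \<longrightarrow>
        lambda_tX \<mu> r (2 * k') (2 * \<nu>) =
          (-1) ^ (k' - \<nu>) / 4 ^ (k' - \<nu>) * of_nat ((k' + \<nu>) choose (k' - \<nu>))) \<and>
      (\<forall>\<nu>. \<nu> < r - k' \<longrightarrow>
        lambda_tX \<mu> r (2 * k') (2 * \<nu> + 1) =
          - \<mu> / 4 ^ (k' - \<nu> - 1) *
          (\<Sum>j=r - k'..k' - 1. (-1) ^ (j - \<nu>) * of_nat ((j + \<nu> + 1) choose (j - \<nu>)))) \<and>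
      (\<forall>\<nu>. r - k' \<le> \<nu> \<and> \<nu> < k' \<longrightarrow>
        lambda_tX \<mu> r (2 * k') (2 * \<nu> + 1) =
          - \<mu> / 4 ^ (k' - \<nu> - 1) *
          (\<Sum>j=\<nu>..k' - 1. (-1) ^ (j - \<nu>) * of_nat ((j + \<nu> + 1) choose (j - \<nu>)))))
    \<and> (\<forall>k'. (r = 2 * r' \<and> r' \<le> k' \<and> k' < r) \<or>
      (r = 2 * r' + 1 \<and> r' + 1 \<le> k' \<and> k' < r) \<longrightarrow>
      (\<forall>\<nu>. \<nu> \<le> k' \<longrightarrow>
        lambda_tX \<mu> r (2 * k' + 1) (2 * \<nu> + 1) =
          (-1) ^ (k' - \<nu>) / 4 ^ (k' - \<nu>) * of_nat ((k' + \<nu> + 1) choose (k' - \<nu>))) \<and>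
      (\<forall>\<nu>. \<nu> < r - k' \<longrightarrow>
        lambda_tX \<mu> r (2 * k' + 1) (2 * \<nu>) =
          - \<mu> / 4 ^ (k' - \<nu>) *
          (\<Sum>j=r - k'..k'. (-1) ^ (j - \<nu>) * of_nat ((j + \<nu>) choose (j - \<nu>)))) \<and>
      (\<forall>\<nu>. r - k' \<le> \<nu> \<and> \<nu> \<le> k' \<longrightarrow>
        lambda_tX \<mu> r (2 * k' + 1) (2 * \<nu>) =
          - \<mu> / 4 ^ (k' - \<nu>) *
          (\<Sum>j=\<nu>..k'. (-1) ^ (j - \<nu>) * of_nat ((j + \<nu>) choose (j - \<nu>)))))
    \<and> (\<forall>n::nat.
      (\<forall>\<nu>. \<nu> \<le> n + r \<longrightarrow>
        lambda_tX \<mu> r (2 * (n + r) + 1) (2 * \<nu> + 1) =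
          (-1) ^ (n + r - \<nu>) / 4 ^ (n + r - \<nu>) * of_nat ((n + r + \<nu> + 1) choose (n + r - \<nu>))) \<and>
      (\<forall>\<nu>. \<nu> < n \<longrightarrow>
        lambda_tX \<mu> r (2 * (n + r) + 1) (2 * \<nu>) =
          - \<mu> / 4 ^ (n + r - \<nu>) *
          (\<Sum>j=n..n + r. (-1) ^ (j - \<nu>) * of_nat ((j + \<nu>) choose (j - \<nu>)))) \<and>
      (\<forall>\<nu>. n \<le> \<nu> \<and> \<nu> \<le> n + r \<longrightarrow>
        lambda_tX \<mu> r (2 * (n + r) + 1) (2 * \<nu>) =
          - \<mu> / 4 ^ (n + r - \<nu>) *
          (\<Sum>j=\<nu>..n + r. (-1) ^ (j - \<nu>) * of_nat ((j + \<nu>) choose (j - \<nu>)))) \<and>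
      (\<forall>\<nu>. \<nu> \<le> n + r + 1 \<longrightarrow>
        lambda_tX \<mu> r (2 * (n + r + 1)) (2 * \<nu>) =
          (-1) ^ (n + r + 1 - \<nu>) / 4 ^ (n + r + 1 - \<nu>) * of_nat ((n + r + 1 + \<nu>) choose (n + r + 1 - \<nu>))) \<and>
      (\<forall>\<nu>. \<nu> < n \<longrightarrow>
        lambda_tX \<mu> r (2 * (n + r + 1)) (2 * \<nu> + 1) =
          - \<mu> / 4 ^ (n + r - \<nu>) *
          (\<Sum>j=n..n + r. (-1) ^ (j - \<nu>) * of_nat ((j + \<nu> + 1) choose (j - \<nu>)))) \<and>
      (\<forall>\<nu>. n \<le> \<nu> \<and> \<nu> \<le> n + r \<longrightarrow>
        lambda_tX \<mu> r (2 * (n + r + 1)) (2 * \<nu> + 1) =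
          - \<mu> / 4 ^ (n + r - \<nu>) *
          (\<Sum>j=\<nu>..n + r. (-1) ^ (j - \<nu>) * of_nat ((j + \<nu> + 1) choose (j - \<nu>)))))"
proof -
  have even_even: "lambda_tX \<mu> r (2 * k) (2 * \<nu>) =
      (-1) ^ (k - \<nu>) / 4 ^ (k - \<nu>) * of_nat ((k + \<nu>) choose (k - \<nu>))" if "\<nu> \<le> k" for k \<nu>
    using lambda_tX_same_parity[OF that, of \<mu> r 0] by simp
  have odd_odd: "lambda_tX \<mu> r (2 * k + 1) (2 * \<nu> + 1) =
      (-1) ^ (k - \<nu>) / 4 ^ (k - \<nu>) * of_nat ((k + \<nu> + 1) choose (k - \<nu>))" if "\<nu> \<le> k" for k \<nu>
    using lambda_tX_same_parity[OF that, of \<mu> r 1] by simp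
  have even_odd_low: "lambda_tX \<mu> r (2 * k) (2 * \<nu> + 1) =
      - \<mu> / 4 ^ (k - \<nu> - 1) *
      (\<Sum>j=max (r - k) \<nu>..k - 1. (-1) ^ (j - \<nu>) * of_nat ((j + \<nu> + 1) choose (j - \<nu>)))"
    if "r' + 1 \<le> k" "k \<le> r" "\<nu> < k" for k \<nu>
  proof -
    \<comment> \<open>The smaller index is \<open>2 * k - 1 - r\<close>, a genuine difference since
      \<open>r \<le> 2 * r' + 1\<close> and \<open>r' + 1 \<le> k\<close>. The gap to
      \<open>r\<close> is \<open>2 * (r - k) + 1\<close>, so \<open>l = r - k\<close> and
      \<open>e = 1\<close>.\<close>
    have "r - k + (2 * k - 1 - r) = k - 1" "r = 2 * k - 1 - r + 2 * (r - k) + 1"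
        "2 * (k - 1) + 1 + 1 = 2 * k" "k - 1 - \<nu> = k - \<nu> - 1"
      using assms that by auto
    then show ?thesis
      using that lambda_tX_opposite_parity[of r "2 * k - 1 - r" "r - k" 1 \<nu> \<mu>] by simp
  qed
  have odd_even_low: "lambda_tX \<mu> r (2 * k + 1) (2 * \<nu>) =
      - \<mu> / 4 ^ (k - \<nu>) *
      (\<Sum>j=max (r - k) \<nu>..k. (-1) ^ (j - \<nu>) * of_nat ((j + \<nu>) choose (j - \<nu>)))"
    if "r \<le> 2 * k" "k < r" "\<nu> \<le> k" for k \<nu>
  proof -
    \<comment> \<open>Here the indices are \<open>2 * k - r\<close> and \<open>r\<close>, with the
      even gap \<open>2 * (r - k)\<close>, so \<open>e = 0\<close>.\<close>
    have "r - k + (2 * k - r) = k" "r = 2 * k - r + 2 * (r - k)"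
      using that by auto
    then show ?thesis
      using that lambda_tX_opposite_parity[of r "2 * k - r" "r - k" 0 \<nu> \<mu>] by simp
  qed
  have odd_even_high: "lambda_tX \<mu> r (2 * (n + r) + 1) (2 * \<nu>) =
      - \<mu> / 4 ^ (n + r - \<nu>) *
      (\<Sum>j=max n \<nu>..n + r. (-1) ^ (j - \<nu>) * of_nat ((j + \<nu>) choose (j - \<nu>)))"
    if "\<nu> \<le> n + r" for n \<nu>
    \<comment> \<open>Now \<open>r\<close> is the smaller index and the other one is
      \<open>r + 2 * n\<close>.\<close>
    using that lambda_tX_opposite_parity[of r r n 0 \<nu> \<mu>] by simp
  have even_odd_high: "lambda_tX \<mu> r (2 * (n + r + 1)) (2 * \<nu> + 1) =
      - \<mu> / 4 ^ (n + r - \<nu>) *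
      (\<Sum>j=max n \<nu>..n + r. (-1) ^ (j - \<nu>) * of_nat ((j + \<nu> + 1) choose (j - \<nu>)))"
    if "\<nu> \<le> n + r" for n \<nu>
    using that lambda_tX_opposite_parity[of r r n 1 \<nu> \<mu>] by simp
  show ?thesis
  \<comment> \<open>In the opposite-parity formulas with a sum, the range of \<open>\<nu>\<close>
    decides which argument of \<open>max\<close> is the lower limit.\<close>
  proof (intro conjI allI impI, goal_cases)
    case (1 k \<nu>)
    then show ?case by (intro even_even)
  next
    case (2 k \<nu>)
    then show ?case using assms by (intro lambda_tX_unperturbed_odd) auto
  next
    case (3 k \<nu>)
    then show ?case by (intro odd_odd)
  next
    case (4 k \<nu>)
    then show ?case by (intro lambda_tX_unperturbed_odd) auto
  next
    case (5 k \<nu>)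
    then show ?case by (intro even_even)
  next
    case (6 k \<nu>)
    then show ?case using assms even_odd_low[of k \<nu>] by (auto simp: max_absorb1)
  next
    case (7 k \<nu>)
    then show ?case using even_odd_low[of k \<nu>] by (simp add: max_absorb2)
  next
    case (8 k \<nu>)
    then show ?case by (intro odd_odd)
  next
    case (9 k \<nu>)
    \<comment> \<open>Both parities of \<open>r\<close> give \<open>r - k \<le> k\<close>, so
      \<open>\<nu> < r - k\<close> forces \<open>\<nu> \<le> k\<close>.\<close>
    then have "r \<le> 2 * k" "k < r" "\<nu> \<le> k" by auto
    with 9 show ?case using odd_even_low[of k \<nu>] by (simp add: max_absorb1)
  next
    case (10 k \<nu>)
    then have "r \<le> 2 * k" "k < r" by auto
    with 10 show ?case using odd_even_low[of k \<nu>] by (simp add: max_absorb2)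
  next
    case (11 n \<nu>)
    then show ?case by (intro odd_odd)
  next
    case (12 n \<nu>)
    then show ?case using odd_even_high[of \<nu> n] by (simp add: max_absorb1)
  next
    case (13 n \<nu>)
    then show ?case using odd_even_high[of \<nu> n] by (simp add: max_absorb2)
  next
    case (14 n \<nu>)
    then show ?case by (intro even_even)
  next
    case (15 n \<nu>)
    then show ?case using even_odd_high[of \<nu> n] by (simp add: max_absorb1)
  next
    case (16 n \<nu>)
    then show ?case using even_odd_high[of \<nu> n] by (simp add: max_absorb2)
  qed
qed

end
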